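(* An element $g\in \mathrm{Sp}(n)$ is strongly reversible in $\mathrm{Sp}(n)$ if and only if every eigenvalue class of $g$ is either $\pm 1$ (i.e. is the class $\{1\}$ or the class $\{-1\}$) or has even multiplicity.
   Context: Let $\mathbb{H}$ be the real quaternions. $\mathrm{Sp}(n)=\{g\in \mathrm{GL}(n,\mathbb{H})\mid {}^{t}\bar g g=I_n\}$, acting on the right $\mathbb{H}$-vector space $\mathbb{H}^n$. An element $g$ of a group $G$ is strongly reversible if there is $x\in G$ with $x^2=1$ and $g^{-1}=xgx^{-1}$. A quaternion $\lambda$ is an eigenvalue of $g$ if $gv=v\lambda$ for some $v\neq 0$. If $\lambda$ is an eigenvalue, so is $\mu^{-1}\lambda\mu$ for every $\mu\in\mathbb{H}\setminus\{0\}$; the similarity class $[\lambda]=\{\mu^{-1}\lambda\mu\}$ is called an eigenvalue class of $g$. Each class contains a unique pair of complex conjugate numbers (a single number if it is real). Every $g\in\mathrm{Sp}(n)$ is conjugate in $\mathrm{Sp}(n)$ to a diagonal matrix $\mathrm{diag}(\lambda_1,\ldots,\lambda_n)$ with $\lambda_k\in\mathbb{C}$, $|\lambda_k|=1$. The multiplicity of an eigenvalue class $[\lambda]$ is the number of indices $k$ with $\lambda_k\in[\lambda]$ in such a diagonal form. *)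

theory Defs
  imports "HOL-Analysis.Analysis" "HOL-Algebra.Group"
begin

text \<open>\<open>Quat a b c d\<close> stands for \<open>a + b i + c j + d k\<close>.\<close>

datatype quat = Quat (qre: real) (qi: real) (qj: real) (qk: real)

instantiation quat :: division_ring
begin

definition zero_quat :: quat where "0 = Quat 0 0 0 0"

definition one_quat :: quat where "1 = Quat 1 0 0 0"

definition plus_quat :: "quat \<Rightarrow> quat \<Rightarrow> quat" where
  "x + y = Quat (qre x + qre y) (qi x + qi y) (qj x + qj y) (qk x + qk y)"

definition minus_quat :: "quat \<Rightarrow> quat \<Rightarrow> quat" where
  "x - y = Quat (qre x - qre y) (qi x - qi y) (qj x - qj y) (qk x - qk y)"

definition uminus_quat :: "quat \<Rightarrow> quat" where
  "- x = Quat (- qre x) (- qi x) (- qj x) (- qk x)"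

definition times_quat :: "quat \<Rightarrow> quat \<Rightarrow> quat" where
  "x * y = Quat
     (qre x * qre y - qi x * qi y - qj x * qj y - qk x * qk y)
     (qre x * qi y + qi x * qre y + qj x * qk y - qk x * qj y)
     (qre x * qj y - qi x * qk y + qj x * qre y + qk x * qi y)
     (qre x * qk y + qi x * qj y - qj x * qi y + qk x * qre y)"

definition inverse_quat :: "quat \<Rightarrow> quat" where
  "inverse x = (let N = (qre x)\<^sup>2 + (qi x)\<^sup>2 + (qj x)\<^sup>2 + (qk x)\<^sup>2 in
     Quat (qre x / N) (- qi x / N) (- qj x / N) (- qk x / N))"

definition divide_quat :: "quat \<Rightarrow> quat \<Rightarrow> quat" where
  "x div y = x * inverse (y :: quat)"

lemmas quat_defs = zero_quat_def one_quat_def plus_quat_def minus_quat_def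
  uminus_quat_def times_quat_def

lemma quat_norm_sq_nonzero:
  fixes x :: quat
  assumes "x \<noteq> 0"
  shows "(qre x)\<^sup>2 + (qi x)\<^sup>2 + (qj x)\<^sup>2 + (qk x)\<^sup>2 \<noteq> 0"
proof
  assume h: "(qre x)\<^sup>2 + (qi x)\<^sup>2 + (qj x)\<^sup>2 + (qk x)\<^sup>2 = 0"
  have "0 \<le> (qre x)\<^sup>2" "0 \<le> (qi x)\<^sup>2" "0 \<le> (qj x)\<^sup>2" "0 \<le> (qk x)\<^sup>2" by simp_all
  with h have "(qre x)\<^sup>2 = 0" "(qi x)\<^sup>2 = 0" "(qj x)\<^sup>2 = 0" "(qk x)\<^sup>2 = 0" by linarith+
  then show False using assms by (cases x) (simp add: zero_quat_def)
qed

instance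
proof
  fix x :: quat
  assume "x \<noteq> 0"
  define N where "N = (qre x)\<^sup>2 + (qi x)\<^sup>2 + (qj x)\<^sup>2 + (qk x)\<^sup>2"
  have N: "N \<noteq> 0" using quat_norm_sq_nonzero[OF \<open>x \<noteq> 0\<close>] by (simp add: N_def)
  have inv: "inverse x = Quat (qre x / N) (- qi x / N) (- qj x / N) (- qk x / N)"
    by (simp add: inverse_quat_def N_def Let_def)
  have sq: "qre x * qre x + qi x * qi x + qj x * qj x + qk x * qk x = N"
    by (simp add: N_def power2_eq_square)
  have e: "qre x * qre x / N + qi x * qi x / N + qj x * qj x / N + qk x * qk x / N = 1"
    using N sq by (simp add: add_divide_distrib[symmetric])
  show "inverse x * x = 1" using e by (simp add: inv times_quat_def one_quat_def)
  show "x * inverse x = 1" using e by (simp add: inv times_quat_def one_quat_def)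
qed (simp_all add: quat_defs divide_quat_def inverse_quat_def algebra_simps)

end

definition qcnj :: "quat \<Rightarrow> quat" where
  "qcnj x = Quat (qre x) (- qi x) (- qj x) (- qk x)"

definition quat_of_complex :: "complex \<Rightarrow> quat" where
  "quat_of_complex z = Quat (Re z) (Im z) 0 0"

definition similarity_class :: "quat \<Rightarrow> quat set" where
  "similarity_class l = {inverse m * l * m | m. m \<noteq> 0}"

definition conj_transpose :: "quat ^ 'n ^ 'm \<Rightarrow> quat ^ 'm ^ 'n" where
  "conj_transpose A = (\<chi> i j. qcnj (A $ j $ i))"

definition diag_matrix :: "('n \<Rightarrow> quat) \<Rightarrow> quat ^ 'n ^ 'n" where
  "diag_matrix d = (\<chi> i j. if i = j then d i else 0)"

definition Sp :: "(quat ^ 'n ^ 'n) monoid" where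
  "Sp = \<lparr>carrier = {g. invertible g \<and> conj_transpose g ** g = mat 1},
         monoid.mult = (**), one = mat 1\<rparr>"

lemma qcnj_simps [simp]:
  "qcnj 0 = 0" "qcnj 1 = 1" "qcnj (x + y) = qcnj x + qcnj y"
  "qcnj (x * y) = qcnj y * qcnj x" "qcnj (qcnj x) = x"
  by (simp_all add: qcnj_def quat_defs algebra_simps)

lemma qcnj_sum: "qcnj (\<Sum>i\<in>A. f i) = (\<Sum>i\<in>A. qcnj (f i))"
  by (induction A rule: infinite_finite_induct) simp_all

lemma conj_transpose_mult: "conj_transpose (A ** B) = conj_transpose B ** conj_transpose A"
  by (simp add: conj_transpose_def matrix_matrix_mult_def qcnj_sum)

lemma conj_transpose_one: "conj_transpose (mat 1) = mat 1"
  by (simp add: conj_transpose_def mat_def vec_eq_iff)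

lemma conj_transpose_conj_transpose [simp]: "conj_transpose (conj_transpose A) = A"
  by (simp add: conj_transpose_def)

lemma Sp_right_inverse:
  assumes "invertible g" "conj_transpose g ** g = mat 1"
  shows "g ** conj_transpose g = mat 1"
proof -
  obtain h where h: "g ** h = mat 1" "h ** g = mat 1"
    using assms(1) by (auto simp: invertible_def)
  have "conj_transpose g = conj_transpose g ** g ** h"
    using h by (simp add: matrix_mul_assoc[symmetric])
  also have "\<dots> = h" using assms(2) by simp
  finally show ?thesis using h by simp
qed

lemma group_Sp: "group (Sp :: (quat ^ 'n ^ 'n) monoid)"
proof (rule groupI)
  fix g :: "quat ^ 'n ^ 'n"
  assume "g \<in> carrier Sp"
  then have g: "invertible g" "conj_transpose g ** g = mat 1" by (auto simp: Sp_def)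
  note r = Sp_right_inverse[OF g]
  have "conj_transpose g \<in> carrier Sp" using g r by (auto simp: Sp_def invertible_def)
  then show "\<exists>h\<in>carrier Sp. h \<otimes>\<^bsub>Sp\<^esub> g = \<one>\<^bsub>Sp\<^esub>" using g by (auto simp: Sp_def)
next
  fix g h :: "quat ^ 'n ^ 'n"
  assume "g \<in> carrier Sp" "h \<in> carrier Sp"
  then have g: "invertible g" "conj_transpose g ** g = mat 1"
    and h: "invertible h" "conj_transpose h ** h = mat 1" by (auto simp: Sp_def)
  have l: "conj_transpose (g ** h) ** (g ** h) = mat 1"
    by (metis conj_transpose_mult g(2) h(2) matrix_mul_assoc matrix_mul_rid)
  have "(g ** h) ** conj_transpose (g ** h) = mat 1"
    by (metis Sp_right_inverse conj_transpose_mult g h matrix_mul_assoc matrix_mul_rid)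
  with l show "g \<otimes>\<^bsub>Sp\<^esub> h \<in> carrier Sp" by (auto simp: Sp_def invertible_def)
qed (auto simp: Sp_def matrix_mul_assoc conj_transpose_one invertible_def)

definition strongly_reversible :: "('a, 'b) monoid_scheme \<Rightarrow> 'a \<Rightarrow> bool" where
  "strongly_reversible G g \<longleftrightarrow>
     (\<exists>x\<in>carrier G. x [^]\<^bsub>G\<^esub> (2::nat) = \<one>\<^bsub>G\<^esub> \<and> inv\<^bsub>G\<^esub> g = x \<otimes>\<^bsub>G\<^esub> g \<otimes>\<^bsub>G\<^esub> inv\<^bsub>G\<^esub> x)"

text \<open>\<open>\<bbbH>\<^sup>n\<close> is a right vector space, so scalars multiply the coordinates from the right.\<close>

definition is_eigenvalue :: "quat ^ 'n ^ 'n \<Rightarrow> quat \<Rightarrow> bool" where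
  "is_eigenvalue g l \<longleftrightarrow> (\<exists>v. v \<noteq> 0 \<and> g *v v = (\<chi> i. v $ i * l))"

definition eigenvalue_classes :: "quat ^ 'n ^ 'n \<Rightarrow> quat set set" where
  "eigenvalue_classes g = {similarity_class l | l. is_eigenvalue g l}"

definition diagonal_form :: "quat ^ 'n ^ 'n \<Rightarrow> ('n \<Rightarrow> complex) \<Rightarrow> bool" where
  "diagonal_form g d \<longleftrightarrow> (\<forall>k. cmod (d k) = 1) \<and>
     (\<exists>u\<in>carrier Sp. u \<otimes>\<^bsub>Sp\<^esub> g \<otimes>\<^bsub>Sp\<^esub> inv\<^bsub>Sp\<^esub> u = diag_matrix (\<lambda>k. quat_of_complex (d k)))"

text \<open>For \<open>g\<close> in \<open>Sp(n)\<close> and an eigenvalue class \<open>C\<close>, a diagonal form exists and the number below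
  does not depend on its choice, so the description is a proper one.\<close>

definition class_multiplicity :: "quat ^ 'n ^ 'n \<Rightarrow> quat set \<Rightarrow> nat" where
  "class_multiplicity g C =
     (THE m. \<exists>d. diagonal_form g d \<and> m = card {k. quat_of_complex (d k) \<in> C})"

end

(* Conjugate g to a diagonal matrix D with complex entries d(k). An x in Sp(n) with
   x D = D^-1 x has x(k,l) = 0 unless Re d(k) = Re d(l), so it is block diagonal with one
   block for every eigenvalue class. If moreover x^2 = 1 and the class is not real, the diagonal
   entries of its block have no real part; the block is an involution of real trace 0, so its
   eigenvalues 1 and -1 are equally frequent and its size is even. Conversely, if the size
   is even, pair the indices of the block and let x swap the two coordinates of each pair,
   with entries 1, 1 or j, -j. *)

theory Submission
  imports Defs
begin

subsection \<open>The quaternions as a Euclidean space\<close>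

text \<open>A single coordinate shows the obstacle: if z is not real, a quaternion a with a z =
  conj(z) a lies in jC, so a unit a has a^2 = -1. It reverses z but is not an involution; parity
  measures whether such coordinates can be paired off. Noncommutativity removes the usual tools:
  eigenvalues are not roots of a commutative determinant, and the trace is not conjugation
  invariant. The real part replaces both. Since Re(xy) = Re(yx), it is constant on similarity
  classes, it separates the classes of unit complex numbers, and its sum along the diagonal is a
  conjugation-invariant trace. Eigenvectors come from maximising a real quadratic form on a compact
  sphere. The resulting diagonalisation serves twice: for g, and for the involution whose trace
  decides the parity.\<close>

lemma quat_eq_iff: "x = y \<longleftrightarrow> qre x = qre y \<and> qi x = qi y \<and> qj x = qj y \<and> qk x = qk y"
  by (auto intro: quat.expand)

lemma quat_sel_simps [simp]:
  "qre 0 = 0" "qi 0 = 0" "qj 0 = 0" "qk 0 = 0"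
  "qre 1 = 1" "qi 1 = 0" "qj 1 = 0" "qk 1 = 0"
  "qre (x + y) = qre x + qre y" "qi (x + y) = qi x + qi y"
  "qj (x + y) = qj x + qj y" "qk (x + y) = qk x + qk y"
  "qre (x - y) = qre x - qre y" "qi (x - y) = qi x - qi y"
  "qj (x - y) = qj x - qj y" "qk (x - y) = qk x - qk y"
  "qre (- x) = - qre x" "qi (- x) = - qi x" "qj (- x) = - qj x" "qk (- x) = - qk x"
  "qre (qcnj x) = qre x" "qi (qcnj x) = - qi x" "qj (qcnj x) = - qj x" "qk (qcnj x) = - qk x"
  by (simp_all add: quat_defs qcnj_def)

instantiation quat :: real_normed_vector
begin

definition scaleR_quat :: "real \<Rightarrow> quat \<Rightarrow> quat" where
  "scaleR r x = Quat (r * qre x) (r * qi x) (r * qj x) (r * qk x)"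

definition norm_quat :: "quat \<Rightarrow> real" where
  "norm x = sqrt ((qre x)\<^sup>2 + (qi x)\<^sup>2 + (qj x)\<^sup>2 + (qk x)\<^sup>2)"

definition sgn_quat :: "quat \<Rightarrow> quat" where
  "sgn x = scaleR (inverse (norm x)) (x::quat)"

definition dist_quat :: "quat \<Rightarrow> quat \<Rightarrow> real" where
  "dist (x::quat) y = norm (x - y)"

definition uniformity_quat :: "(quat \<times> quat) filter" where
  "(uniformity :: (quat \<times> quat) filter) = (INF e\<in>{0 <..}. principal {(x, y). dist x y < e})"

definition open_quat :: "quat set \<Rightarrow> bool" where
  "open (U :: quat set) \<longleftrightarrow> (\<forall>x\<in>U. eventually (\<lambda>(x', y). x' = x \<longrightarrow> y \<in> U) uniformity)"

instance
proof
  fix r :: real and x y :: quat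
  \<comment> \<open>Viewing a quaternion as a nested pair of reals lets the norm axioms be inherited
    from the product norm.\<close>
  have n: "norm z = norm ((qre z, qi z), (qj z, qk z))" for z :: quat
    by (simp add: norm_quat_def norm_Pair)
  show "norm x = 0 \<longleftrightarrow> x = 0"
    unfolding n by (simp add: zero_prod_def quat_eq_iff)
  show "norm (x + y) \<le> norm x + norm y"
    unfolding n using norm_triangle_ineq[of "((qre x, qi x), (qj x, qk x))" "((qre y, qi y), (qj y, qk y))"]
    by simp
  show "norm (r *\<^sub>R x) = \<bar>r\<bar> * norm x"
    unfolding n norm_scaleR[symmetric] by (simp add: scaleR_quat_def)
qed (simp_all add: scaleR_quat_def quat_eq_iff algebra_simps
      sgn_quat_def dist_quat_def uniformity_quat_def open_quat_def)

end

instantiation quat :: real_inner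
begin

definition inner_quat :: "quat \<Rightarrow> quat \<Rightarrow> real" where
  "inner x y = qre x * qre y + qi x * qi y + qj x * qj y + qk x * qk y"

instance
proof
  fix x :: quat
  show "inner x x = 0 \<longleftrightarrow> x = 0"
    by (simp add: inner_quat_def quat_eq_iff add_nonneg_eq_0_iff)
qed (simp_all add: scaleR_quat_def inner_quat_def algebra_simps norm_quat_def power2_eq_square)

end

lemma quat_scaleR_sel [simp]:
  fixes x :: quat
  shows "qre (r *\<^sub>R x) = r * qre x" "qi (r *\<^sub>R x) = r * qi x"
    "qj (r *\<^sub>R x) = r * qj x" "qk (r *\<^sub>R x) = r * qk x"
  by (simp_all add: scaleR_quat_def)

lemma quat_times_sel:
  fixes x y :: quat
  shows
  "qre (x * y) = qre x * qre y - qi x * qi y - qj x * qj y - qk x * qk y"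
  "qi (x * y) = qre x * qi y + qi x * qre y + qj x * qk y - qk x * qj y"
  "qj (x * y) = qre x * qj y - qi x * qk y + qj x * qre y + qk x * qi y"
  "qk (x * y) = qre x * qk y + qi x * qj y - qj x * qi y + qk x * qre y"
  by (simp_all add: times_quat_def)

instance quat :: real_normed_div_algebra
proof
  fix r :: real and x y :: quat
  show "r *\<^sub>R x * y = r *\<^sub>R (x * y)" "x * r *\<^sub>R y = r *\<^sub>R (x * y)"
    by (simp_all add: quat_eq_iff quat_times_sel algebra_simps)
  \<comment> \<open>Euler's four-square identity.\<close>
  have "inner (x * y) (x * y) = inner x x * inner y y"
    unfolding inner_quat_def quat_times_sel by (simp add: algebra_simps)
  then show "norm (x * y) = norm x * norm y"
    by (simp add: norm_eq_sqrt_inner real_sqrt_mult)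
qed

text \<open>This makes \<open>quat ^ 'n\<close> a finite-dimensional real space: its unit sphere is
  compact, and an injective real-linear endomorphism is surjective. Both facts are used
  below.\<close>

instantiation quat :: euclidean_space
begin

definition Basis_quat :: "quat set" where
  "Basis_quat = {Quat 1 0 0 0, Quat 0 1 0 0, Quat 0 0 1 0, Quat 0 0 0 1}"

instance
proof
  show "finite (Basis :: quat set)" "(Basis :: quat set) \<noteq> {}"
    by (simp_all add: Basis_quat_def)
next
  fix u v :: quat
  assume "u \<in> Basis" "v \<in> Basis"
  then show "inner u v = (if u = v then 1 else 0)"
    unfolding Basis_quat_def by (elim insertE; simp add: inner_quat_def)
next
  fix x :: quat
  show "(\<forall>u\<in>Basis. inner x u = 0) \<longleftrightarrow> x = 0"
    by (simp add: Basis_quat_def inner_quat_def) (simp add: quat_eq_iff)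
qed

end

lemma norm_qcnj [simp]: "norm (qcnj x) = norm x"
  by (simp add: norm_quat_def)

lemma norm_quat_sq: "(norm x)\<^sup>2 = (qre x)\<^sup>2 + (qi x)\<^sup>2 + (qj x)\<^sup>2 + (qk x)\<^sup>2"
  unfolding power2_norm_eq_inner by (simp add: inner_quat_def power2_eq_square)

lemma qcnj_mult_self: "qcnj x * x = of_real ((norm x)\<^sup>2)" "x * qcnj x = of_real ((norm x)\<^sup>2)"
  unfolding norm_quat_sq of_real_def
  by (simp_all add: quat_eq_iff quat_times_sel power2_eq_square)

lemma qcnj_minus [simp]: "qcnj (- x) = - qcnj x" "qcnj (x - y) = qcnj x - qcnj y"
  by (simp_all add: quat_eq_iff)

lemma qcnj_scaleR [simp]: "qcnj (r *\<^sub>R x) = r *\<^sub>R qcnj x"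
  by (simp add: quat_eq_iff)

lemma qre_sum: "qre (\<Sum>i\<in>A. f i) = (\<Sum>i\<in>A. qre (f i))"
  by (induction A rule: infinite_finite_induct) simp_all

lemma qre_mult_commute: "qre (x * y) = qre (y * x)"
  by (simp add: quat_times_sel algebra_simps)

lemma inner_quat_eq: "inner x y = qre (qcnj x * y)"
  by (simp add: inner_quat_def quat_times_sel)

subsection \<open>Complex numbers inside the quaternions\<close>

lemma quat_of_complex_sel [simp]:
  "qre (quat_of_complex z) = Re z" "qi (quat_of_complex z) = Im z"
  "qj (quat_of_complex z) = 0" "qk (quat_of_complex z) = 0"
  by (simp_all add: quat_of_complex_def)

lemma quat_of_complex_simps [simp]:
  "quat_of_complex 1 = 1" "quat_of_complex (-1) = -1"
  "quat_of_complex (cnj z) = qcnj (quat_of_complex z)"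
  "norm (quat_of_complex z) = cmod z"
  by (simp_all add: quat_eq_iff norm_quat_def norm_complex_def power2_eq_square)

lemma quat_of_complex_mult: "quat_of_complex (z * w) = quat_of_complex z * quat_of_complex w"
  by (simp add: quat_eq_iff quat_times_sel)

lemma quat_of_complex_inj: "quat_of_complex z = quat_of_complex w \<longleftrightarrow> z = w"
  by (simp add: quat_eq_iff complex_eq_iff)

lemma unit_Re_eq_iff:
  assumes "cmod z = 1" "cmod w = 1"
  shows "Re z = Re w \<longleftrightarrow> z = w \<or> z = cnj w"
proof
  assume "Re z = Re w"
  moreover have "(Re z)\<^sup>2 + (Im z)\<^sup>2 = 1" "(Re w)\<^sup>2 + (Im w)\<^sup>2 = 1"
    using assms by (simp_all add: cmod_power2[symmetric])
  ultimately have "(Im z)\<^sup>2 = (Im w)\<^sup>2" by simp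
  with \<open>Re z = Re w\<close> show "z = w \<or> z = cnj w"
    by (auto simp: power2_eq_iff complex_eq_iff)
qed auto

definition quat_j :: quat where "quat_j = Quat 0 0 1 0"

lemma quat_j_mult_complex: "quat_j * quat_of_complex z = qcnj (quat_of_complex z) * quat_j"
  by (simp add: quat_eq_iff quat_times_sel quat_j_def)

lemma quat_j_nonzero [simp]: "quat_j \<noteq> 0"
  by (simp add: quat_eq_iff quat_j_def)

lemma norm_quat_j [simp]: "norm quat_j = 1"
  by (simp add: quat_j_def norm_quat_def)

text \<open>The real part is conjugation invariant and p = u^-1 q u. Applied to single entries, this
  forces a matrix intertwining two diagonal matrices to vanish wherever the real parts
  differ.\<close>

lemma qre_eq_of_intertwine:
  fixes p q u :: quat
  assumes "u * p = q * u" "u \<noteq> 0"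
  shows "qre p = qre q"
proof -
  have "p = inverse u * (q * u)"
    using assms by (metis left_inverse mult.assoc mult_1_left)
  then show ?thesis
    using assms(2) by (metis qre_mult_commute mult.assoc mult_1_right right_inverse)
qed

lemma similarity_class_self: "l \<in> similarity_class l"
  unfolding similarity_class_def by (auto intro!: exI[of _ 1])

lemma similarity_class_conj:
  assumes "m \<noteq> 0"
  shows "similarity_class (inverse m * l * m) = similarity_class l"
proof -
  have "\<exists>b. inverse a * (inverse m * l * m) * a = inverse b * l * b \<and> b \<noteq> 0" if "a \<noteq> 0" for a
    using that assms by (intro exI[of _ "m * a"]) (simp add: nonzero_inverse_mult_distrib mult.assoc)
  moreover
  have cancel: "m * (inverse m * x) = x" for x
    using assms by (simp add: mult.assoc[symmetric])
  have "\<exists>b. inverse a * l * a = inverse b * (inverse m * l * m) * b \<and> b \<noteq> 0" if "a \<noteq> 0" for a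
    using that assms
    by (intro exI[of _ "inverse m * a"]) (simp add: nonzero_inverse_mult_distrib mult.assoc cancel)
  ultimately show ?thesis unfolding similarity_class_def by fastforce
qed

text \<open>Conjugation by j maps z to its complex conjugate, so a class meets the unit circle in
  one conjugate pair. From here on \<open>Re\<close> stands for the class.\<close>

lemma quat_of_complex_mem_similarity_class_iff:
  assumes "cmod z = 1" "cmod w = 1"
  shows "quat_of_complex w \<in> similarity_class (quat_of_complex z) \<longleftrightarrow> Re w = Re z"
proof
  assume "quat_of_complex w \<in> similarity_class (quat_of_complex z)"
  then obtain m where m: "m \<noteq> 0" "quat_of_complex w = inverse m * quat_of_complex z * m"
    by (auto simp: similarity_class_def)
  then have "m * quat_of_complex w = quat_of_complex z * m"
    by (simp add: mult.assoc[symmetric])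
  from qre_eq_of_intertwine[OF this m(1)] show "Re w = Re z" by simp
next
  assume "Re w = Re z"
  then consider "w = z" | "w = cnj z" using unit_Re_eq_iff[OF assms(2,1)] by blast
  then show "quat_of_complex w \<in> similarity_class (quat_of_complex z)"
  proof cases
    case 2
    have "quat_j * quat_of_complex w = quat_of_complex z * quat_j"
      by (simp add: quat_j_mult_complex[of "cnj z", simplified] 2)
    then have "quat_of_complex w = inverse quat_j * quat_of_complex z * quat_j"
      by (metis left_inverse mult.assoc mult_1_left quat_j_nonzero)
    then show ?thesis unfolding similarity_class_def using quat_j_nonzero by blast
  qed (simp add: similarity_class_self)
qed

lemma similarity_class_singleton_iff:
  assumes "cmod z = 1"
  shows "similarity_class (quat_of_complex z) = {1} \<or> similarity_class (quat_of_complex z) = {-1}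
    \<longleftrightarrow> Re z = 1 \<or> Re z = -1"
proof
  assume "similarity_class (quat_of_complex z) = {1} \<or> similarity_class (quat_of_complex z) = {-1}"
  then have "quat_of_complex z = 1 \<or> quat_of_complex z = -1"
    using similarity_class_self by blast
  then show "Re z = 1 \<or> Re z = -1" by (auto simp: quat_eq_iff)
next
  assume *: "Re z = 1 \<or> Re z = -1"
  have "similarity_class 1 = {1}" "similarity_class (-1) = {-1}"
    by (auto simp: similarity_class_def intro!: exI[of _ 1])
  moreover have "z = 1 \<or> z = -1"
    using * unit_Re_eq_iff[of z 1] unit_Re_eq_iff[of z "-1"] assms by auto
  ultimately show "similarity_class (quat_of_complex z) = {1} \<or> similarity_class (quat_of_complex z) = {-1}"
    by auto
qed

subsection \<open>The right vector space of quaternionic columns\<close>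

text \<open>The Hermitian form of the right vector space. With the conjugate on the first factor,
  right scalars leave the second argument on the right, and the real part is the Euclidean inner
  product.\<close>

definition hdot :: "quat ^ 'n \<Rightarrow> quat ^ 'n \<Rightarrow> quat" where
  "hdot v w = (\<Sum>i\<in>UNIV. qcnj (v $ i) * w $ i)"

definition rscale :: "quat ^ 'n \<Rightarrow> quat \<Rightarrow> quat ^ 'n" where
  "rscale v q = (\<chi> i. v $ i * q)"

lemma inner_eq_hdot: "inner v w = qre (hdot v w)"
  by (simp add: inner_vec_def hdot_def qre_sum inner_quat_eq)

lemma hdot_simps [simp]:
  "hdot v 0 = 0" "hdot 0 v = 0"
  "hdot v (w + x) = hdot v w + hdot v x" "hdot (v + x) w = hdot v w + hdot x w"
  "hdot v (w - x) = hdot v w - hdot v x" "hdot (v - x) w = hdot v w - hdot x w"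
  "hdot v (r *\<^sub>R w) = r *\<^sub>R hdot v w" "hdot (r *\<^sub>R v) w = r *\<^sub>R hdot v w"
  "hdot v (rscale w q) = hdot v w * q" "hdot (rscale v q) w = qcnj q * hdot v w"
  by (simp_all add: hdot_def rscale_def algebra_simps sum.distrib sum_subtractf
      scaleR_sum_right sum_distrib_left sum_distrib_right)

lemma qcnj_hdot: "qcnj (hdot v w) = hdot w v"
  by (simp add: hdot_def qcnj_sum)

lemma hdot_self: "hdot v v = of_real ((norm v)\<^sup>2)"
  by (simp add: hdot_def qcnj_mult_self norm_vec_def L2_set_def sum_nonneg)

lemma rscale_simps [simp]:
  "rscale v 1 = v" "rscale (rscale v p) q = rscale v (p * q)"
  "rscale (v - w) q = rscale v q - rscale w q" "rscale (r *\<^sub>R v) q = r *\<^sub>R rscale v q"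
  by (simp_all add: rscale_def vec_eq_iff mult.assoc left_diff_distrib)

lemma rscale_add_right: "rscale v (p + q) = rscale v p + rscale v q"
  by (simp add: rscale_def vec_eq_iff distrib_left)

lemma rscale_of_real: "rscale v (of_real r) = r *\<^sub>R v"
  by (simp add: rscale_def vec_eq_iff of_real_def)

lemma mult_rscale: "A *v rscale v q = rscale (A *v v) q"
  by (simp add: rscale_def vec_eq_iff matrix_vector_mult_def sum_distrib_right mult.assoc)

lemma mult_scaleR: "A *v (r *\<^sub>R v) = r *\<^sub>R (A *v v)" for A :: "quat ^ 'n ^ 'm"
  by (simp add: vec_eq_iff matrix_vector_mult_def scaleR_sum_right)

lemma linear_quat_mult: "linear ((*v) A)" for A :: "quat ^ 'n ^ 'm"
  by (intro linearI) (simp_all add: matrix_vector_right_distrib mult_scaleR)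

lemma hdot_mult: "hdot (A *v v) w = hdot v (conj_transpose A *v w)"
proof -
  have "hdot (A *v v) w = (\<Sum>i\<in>UNIV. \<Sum>j\<in>UNIV. qcnj (v $ j) * (qcnj (A $ i $ j) * w $ i))"
    by (simp add: hdot_def matrix_vector_mult_def qcnj_sum sum_distrib_right mult.assoc)
  also have "\<dots> = (\<Sum>j\<in>UNIV. \<Sum>i\<in>UNIV. qcnj (v $ j) * (qcnj (A $ i $ j) * w $ i))"
    by (rule sum.swap)
  also have "\<dots> = hdot v (conj_transpose A *v w)"
    by (simp add: hdot_def matrix_vector_mult_def conj_transpose_def sum_distrib_left)
  finally show ?thesis .
qed

subsection \<open>The group \<open>Sp(n)\<close>\<close>

lemma Sp_simps [simp]: "A \<otimes>\<^bsub>Sp\<^esub> B = A ** B" "\<one>\<^bsub>Sp\<^esub> = mat 1"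
  by (simp_all add: Sp_def)

lemma Sp_iff: "g \<in> carrier Sp \<longleftrightarrow> conj_transpose g ** g = mat 1 \<and> g ** conj_transpose g = mat 1"
  using Sp_right_inverse[of g] by (auto simp: Sp_def invertible_def)

lemma SpD:
  assumes "g \<in> carrier Sp"
  shows "conj_transpose g ** g = mat 1" "g ** conj_transpose g = mat 1"
    "conj_transpose g ** (g ** A) = A" "g ** (conj_transpose g ** A) = A"
    "conj_transpose g *v (g *v v) = v" "g *v (conj_transpose g *v v) = v"
  using assms by (simp_all add: Sp_iff matrix_mul_assoc matrix_vector_mul_assoc)

lemma conj_transpose_in_Sp: "g \<in> carrier Sp \<Longrightarrow> conj_transpose g \<in> carrier Sp"
  by (simp add: Sp_iff)

lemma Sp_mult: "g \<in> carrier Sp \<Longrightarrow> h \<in> carrier Sp \<Longrightarrow> g ** h \<in> carrier Sp"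
  using monoid.m_closed[OF group.is_monoid[OF group_Sp]] by fastforce

lemma inv_Sp: "g \<in> carrier Sp \<Longrightarrow> inv\<^bsub>Sp\<^esub> g = conj_transpose g"
  by (rule group.inv_equality[OF group_Sp]) (simp_all add: SpD conj_transpose_in_Sp)

text \<open>A left inverse makes \<open>g\<close> injective; viewed as a real-linear map in finite
  dimension it is then surjective, so the left inverse is two-sided.\<close>

lemma Sp_of_left_inverse:
  fixes g :: "quat ^ 'n ^ 'n"
  assumes "conj_transpose g ** g = mat 1"
  shows "g \<in> carrier Sp"
proof -
  have l: "conj_transpose g *v (g *v v) = v" for v
    by (simp add: matrix_vector_mul_assoc assms)
  then have "inj ((*v) g)" by (metis injI)
  then have "surj ((*v) g)"
    using linear_injective_imp_surjective[OF linear_quat_mult, of g] by simp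
  then have "(g ** conj_transpose g) *v w = mat 1 *v w" for w
    by (metis l matrix_vector_mul_assoc matrix_vector_mul_lid surjD)
  then have "g ** conj_transpose g = mat 1" by (simp add: matrix_eq)
  with assms show ?thesis by (simp add: Sp_iff)
qed

lemma strongly_reversible_Sp_iff:
  fixes g :: "quat ^ 'n ^ 'n"
  assumes "g \<in> carrier Sp"
  shows "strongly_reversible Sp g \<longleftrightarrow>
    (\<exists>x\<in>carrier Sp. x ** x = mat 1 \<and> x ** g = conj_transpose g ** x)"
proof -
  have "conj_transpose g = x ** g ** conj_transpose x \<longleftrightarrow> x ** g = conj_transpose g ** x"
    if "x \<in> carrier Sp" for x
    using SpD[OF that] by (metis matrix_mul_assoc matrix_mul_rid)
  moreover have "x [^]\<^bsub>Sp\<^esub> (2::nat) = x ** x" for x :: "quat ^ 'n ^ 'n"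
    by (simp add: numeral_2_eq_2 nat_pow_def)
  ultimately show ?thesis
    unfolding strongly_reversible_def by (auto simp: inv_Sp assms)
qed

lemma diagonal_form_iff:
  assumes "g \<in> carrier Sp"
  shows "diagonal_form g d \<longleftrightarrow> (\<forall>k. cmod (d k) = 1) \<and>
    (\<exists>u\<in>carrier Sp. u ** g = diag_matrix (\<lambda>k. quat_of_complex (d k)) ** u)"
proof -
  have "u ** g ** conj_transpose u = D \<longleftrightarrow> u ** g = D ** u" if "u \<in> carrier Sp" for u D
    using SpD[OF that] by (metis matrix_mul_assoc matrix_mul_rid)
  then show ?thesis unfolding diagonal_form_def by (auto simp: inv_Sp)
qed

lemma diag_matrix_mult: "(diag_matrix d ** A) $ i $ j = d i * A $ i $ j"
  by (simp add: matrix_matrix_mult_def diag_matrix_def if_distrib[of "\<lambda>x. x * _"] cong: if_cong)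

lemma mult_diag_matrix: "(A ** diag_matrix d) $ i $ j = A $ i $ j * d j"
  by (simp add: matrix_matrix_mult_def diag_matrix_def if_distrib[of "\<lambda>x. _ * x"] cong: if_cong)

lemma diag_matrix_vector: "(diag_matrix d *v v) $ i = d i * v $ i"
  by (simp add: matrix_vector_mult_def diag_matrix_def if_distrib[of "\<lambda>x. x * _"] cong: if_cong)

lemma conj_transpose_diag_matrix: "conj_transpose (diag_matrix d) = diag_matrix (\<lambda>k. qcnj (d k))"
  by (simp add: conj_transpose_def diag_matrix_def vec_eq_iff)

lemma diag_matrix_in_Sp:
  assumes "\<And>k. norm (d k) = 1"
  shows "diag_matrix d \<in> carrier Sp"
  by (rule Sp_of_left_inverse)
    (simp add: vec_eq_iff conj_transpose_diag_matrix diag_matrix_mult,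
      simp add: diag_matrix_def mat_def qcnj_mult_self assms)

lemma sum_norm_row:
  assumes "g \<in> carrier Sp"
  shows "(\<Sum>j\<in>UNIV. (norm (g $ i $ j))\<^sup>2) = 1" "(\<Sum>j\<in>UNIV. (norm (g $ j $ i))\<^sup>2) = 1"
proof -
  have "(g ** conj_transpose g) $ i $ i = 1" "(conj_transpose g ** g) $ i $ i = 1"
    using SpD[OF assms] by (simp_all add: mat_def)
  then have "of_real (\<Sum>j\<in>UNIV. (norm (g $ i $ j))\<^sup>2) = (1::quat)"
    "of_real (\<Sum>j\<in>UNIV. (norm (g $ j $ i))\<^sup>2) = (1::quat)"
    by (simp_all add: matrix_matrix_mult_def conj_transpose_def qcnj_mult_self)
  then show "(\<Sum>j\<in>UNIV. (norm (g $ i $ j))\<^sup>2) = 1" "(\<Sum>j\<in>UNIV. (norm (g $ j $ i))\<^sup>2) = 1"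
    by (simp_all only: of_real_eq_1_iff)
qed

subsection \<open>Diagonalisation\<close>

text \<open>The polynomial has a maximum at s = 0, so its derivative a vanishes there. Concretely, s
  = a e with \<bar>b\<bar> e < 1 would give the positive value a^2 e (1 + b e).\<close>

lemma linear_coeff_zero_of_quadratic_nonpos:
  fixes a b :: real
  assumes "\<And>s. a * s + b * s\<^sup>2 \<le> 0"
  shows "a = 0"
proof (rule ccontr)
  assume "a \<noteq> 0"
  define e where "e = 1 / (1 + \<bar>b\<bar>)"
  have "e > 0" by (simp add: e_def)
  have "\<bar>b\<bar> * e < 1" by (simp add: e_def)
  then have "0 < 1 + b * e"
    using \<open>e > 0\<close> abs_ge_minus_self[of "b * e"] by (simp add: abs_mult)
  then have "0 < a\<^sup>2 * e * (1 + b * e)"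
    using \<open>a \<noteq> 0\<close> \<open>e > 0\<close> by simp
  also have "\<dots> = a * (a * e) + b * (a * e)\<^sup>2"
    by (simp add: power2_eq_square algebra_simps)
  finally show False using assms[of "a * e"] by simp
qed

text \<open>A maximiser \<open>v\<close> of \<open>v \<bullet> gv\<close> on the unit sphere satisfies \<open>(g + g\<^sup>*) v = 2cv\<close>, hence
  \<open>(g\<^sup>2 - 2cg + 1) v = 0\<close>. This quadratic splits over \<open>\<complex>\<close> with roots \<open>\<lambda>, \<mu>\<close>, so
  \<open>gv - v\<mu>\<close> is either zero or an eigenvector for \<open>\<lambda>\<close>.\<close>

lemma unit_eigenvector_in_invariant_subspace:
  fixes g :: "quat ^ 'n ^ 'n" and W :: "(quat ^ 'n) set"
  assumes g: "g \<in> carrier Sp" and W: "subspace W" "W \<noteq> {0}"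
    and inv: "\<And>w. w \<in> W \<Longrightarrow> g *v w \<in> W" "\<And>w. w \<in> W \<Longrightarrow> conj_transpose g *v w \<in> W"
      "\<And>w q. w \<in> W \<Longrightarrow> rscale w q \<in> W"
  obtains v z where "v \<in> W" "norm v = 1" "cmod z = 1" "g *v v = rscale v (quat_of_complex z)"
proof -
  define h where "h w = inner w (g *v w)" for w
  define K where "K = sphere 0 1 \<inter> W"
  have "compact K"
    unfolding K_def by (intro compact_Int_closed compact_sphere closed_subspace W)
  obtain w0 where w0: "w0 \<in> W" "w0 \<noteq> 0" using W subspace_0[OF W(1)] by blast
  then have "w0 /\<^sub>R norm w0 \<in> K"
    unfolding K_def using subspace_scale[OF W(1)] by auto
  then have "K \<noteq> {}" by blast
  have "continuous_on K h"
    unfolding h_def by (intro continuous_intros linear_continuous_on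
        linear_conv_bounded_linear[THEN iffD1] linear_quat_mult)
  then obtain v where v: "v \<in> K" "\<And>w. w \<in> K \<Longrightarrow> h w \<le> h v"
    using continuous_attains_sup[OF \<open>compact K\<close> \<open>K \<noteq> {}\<close>] by blast
  then have vW: "v \<in> W" and nv: "norm v = 1" by (auto simp: K_def)
  define c where "c = h v"
  have h_scale: "h (r *\<^sub>R w) = r\<^sup>2 * h w" for r w
    by (simp add: h_def mult_scaleR power2_eq_square)
  \<comment> \<open>Homogeneity turns maximality on the sphere into an inequality on all of
    \<open>W\<close>, with equality at \<open>v\<close>.\<close>
  have h_le: "h w \<le> c * (norm w)\<^sup>2" if "w \<in> W" for w
  proof (cases "w = 0")
    case False
    then have "w /\<^sub>R norm w \<in> K"
      unfolding K_def using that subspace_scale[OF W(1)] by auto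
    from v(2)[OF this] have "h w / (norm w)\<^sup>2 \<le> c"
      by (simp add: h_scale c_def divide_inverse power_inverse mult.commute)
    then show ?thesis using False by (simp add: divide_le_eq)
  qed (simp add: h_def)
  \<comment> \<open>The gradient at \<open>v\<close> of h(w) - c \<bar>w\<bar>^2. It lies in
    \<open>W\<close> because \<open>W\<close> is also invariant under the adjoint. Moving from
    \<open>v\<close> along \<open>t\<close> gives a quadratic in s with linear coefficient
    \<bar>t\<bar>^2, so maximality forces t = 0.\<close>
  define t where "t = g *v v + conj_transpose g *v v - (2 * c) *\<^sub>R v"
  have tW: "t \<in> W"
    unfolding t_def by (intro subspace_add subspace_diff subspace_scale W inv vW)
  have adj: "inner x (conj_transpose g *v y) = inner y (g *v x)" for x y
  proof -
    have "inner x (conj_transpose g *v y) = inner (g *v x) y"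
      by (simp add: inner_eq_hdot hdot_mult)
    then show ?thesis by (simp add: inner_commute)
  qed
  have "(norm t)\<^sup>2 * s + (h t - c * (norm t)\<^sup>2) * s\<^sup>2 \<le> 0" for s
  proof -
    have "h (v + s *\<^sub>R t) = c + s * (inner t (g *v v) + inner v (g *v t)) + s\<^sup>2 * h t"
      by (simp add: h_def c_def matrix_vector_right_distrib mult_scaleR inner_add_left
          inner_add_right power2_eq_square algebra_simps)
    moreover have "(norm (v + s *\<^sub>R t))\<^sup>2 = 1 + 2 * s * inner t v + s\<^sup>2 * (norm t)\<^sup>2"
      using nv unfolding power2_norm_eq_inner norm_eq_1
      by (simp add: inner_add_left inner_add_right power2_eq_square inner_commute algebra_simps)
    moreover have "h (v + s *\<^sub>R t) \<le> c * (norm (v + s *\<^sub>R t))\<^sup>2"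
      by (intro h_le subspace_add subspace_scale W vW tW)
    ultimately have "s * (inner t (g *v v) + inner v (g *v t) - 2 * c * inner t v) + s\<^sup>2 * h t
        \<le> c * (s\<^sup>2 * (norm t)\<^sup>2)"
      by (simp add: algebra_simps)
    moreover have tt: "(norm t)\<^sup>2 = inner t (g *v v) + inner v (g *v t) - 2 * c * inner t v"
      unfolding power2_norm_eq_inner
      by (subst (2) t_def) (simp add: inner_add_right inner_diff_right adj)
    ultimately show ?thesis unfolding tt[symmetric] by (simp add: algebra_simps)
  qed
  then have "(norm t)\<^sup>2 = 0" by (rule linear_coeff_zero_of_quadratic_nonpos)
  then have sum_eq: "g *v v + conj_transpose g *v v = (2 * c) *\<^sub>R v" by (simp add: t_def)
  have "norm (g *v v) = 1"
    using nv SpD(5)[OF g, of v] by (simp add: norm_eq_1 inner_eq_hdot hdot_mult)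
  then have "\<bar>c\<bar> \<le> 1"
    using Cauchy_Schwarz_ineq2[of v "g *v v"] nv by (simp add: c_def h_def)
  then have c2: "c\<^sup>2 \<le> 1" by (simp add: abs_square_le_1)
  \<comment> \<open>A root of X^2 - 2cX + 1; the other one is its conjugate, and \<bar>c\<bar> \<le>
    1 puts both on the unit circle.\<close>
  define z where "z = Complex c (sqrt (1 - c\<^sup>2))"
  let ?l = "quat_of_complex z"
  have z: "cmod z = 1" using c2 by (simp add: z_def cmod_def)
  have ll: "qcnj ?l * ?l = 1" by (simp add: qcnj_mult_self z)
  have l2: "?l + qcnj ?l = of_real (2 * c)"
    by (simp add: quat_eq_iff z_def of_real_def)
  define w where "w = g *v v - rscale v (qcnj ?l)"
  have "g *v (g *v v) = (2 * c) *\<^sub>R (g *v v) - v"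
    using arg_cong[OF sum_eq, of "(*v) g"]
    by (simp add: matrix_vector_right_distrib mult_scaleR SpD[OF g] algebra_simps)
  also have "(2 * c) *\<^sub>R (g *v v) = rscale (g *v v) ?l + rscale (g *v v) (qcnj ?l)"
    by (simp only: rscale_add_right[symmetric] l2 rscale_of_real)
  finally have gw: "g *v w = rscale w ?l"
    by (simp add: w_def matrix_vector_mult_diff_distrib mult_rscale ll)
  show thesis
  proof (cases "w = 0")
    case True
    then have "g *v v = rscale v (quat_of_complex (cnj z))" by (simp add: w_def)
    with vW nv z show thesis by (intro that[of v "cnj z"]) auto
  next
    case False
    have "w \<in> W" unfolding w_def by (intro subspace_diff W inv vW)
    with False gw z show thesis
      by (intro that[of "w /\<^sub>R norm w" z]) (auto simp: mult_scaleR subspace_scale W)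
  qed
qed

text \<open>Induction over sets of indices: the next eigenvector is taken from the orthogonal
  complement of those already found, which is nonzero because an index is still free and is
  invariant under \<open>g\<close> and its adjoint.\<close>

lemma orthonormal_eigenvectors:
  fixes g :: "quat ^ 'n ^ 'n" and I :: "'n set"
  assumes g: "g \<in> carrier Sp"
  shows "\<exists>v z. \<forall>i\<in>I. cmod (z i) = 1 \<and> g *v v i = rscale (v i) (quat_of_complex (z i)) \<and>
    (\<forall>j\<in>I. hdot (v i) (v j) = (if i = j then 1 else 0))"
proof (induction I rule: finite_induct[OF finite])
  case 1
  show ?case by simp
next
  case (2 k I)
  then obtain v z where vz: "\<And>i. i \<in> I \<Longrightarrow> cmod (z i) = 1"
    "\<And>i. i \<in> I \<Longrightarrow> g *v v i = rscale (v i) (quat_of_complex (z i))"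
    "\<And>i j. i \<in> I \<Longrightarrow> j \<in> I \<Longrightarrow> hdot (v i) (v j) = (if i = j then 1 else 0)"
    by metis
  define W where "W = {w. \<forall>i\<in>I. hdot (v i) w = 0}"
  have W: "subspace W" unfolding W_def subspace_def by simp
  \<comment> \<open>The kernel of \<open>L\<close> is \<open>W\<close>. As its image misses the axis
    of the free index \<open>k\<close>, \<open>L\<close> is not surjective, hence not injective;
    this gives W \<noteq> {0} without a quaternionic dimension theory.\<close>
  define L :: "quat ^ 'n \<Rightarrow> quat ^ 'n" where "L w = (\<chi> i. if i \<in> I then hdot (v i) w else 0)" for w
  have "linear L" by (intro linearI) (simp_all add: L_def vec_eq_iff)
  have "L w \<noteq> axis k 1" for w using 2 by (auto simp: L_def vec_eq_iff axis_def intro!: exI[of _ k])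
  then have "\<not> surj L" by (metis surjD)
  then have "\<not> inj L" using linear_injective_imp_surjective[OF \<open>linear L\<close>] by auto
  then obtain w where "L w = 0" "w \<noteq> 0"
    using linear_injective_0[OF \<open>linear L\<close>] by blast
  then have "w \<in> W" by (auto simp: W_def L_def vec_eq_iff split: if_splits)
  with \<open>w \<noteq> 0\<close> have "W \<noteq> {0}" by blast
  \<comment> \<open>Since the eigenvalue has norm 1, the adjoint acts on the same vector by its
    conjugate. Moving \<open>g\<close> or its adjoint across \<open>hdot\<close> therefore keeps the
    complement invariant.\<close>
  have ct: "conj_transpose g *v v i = rscale (v i) (qcnj (quat_of_complex (z i)))" if "i \<in> I" for i
  proof -
    have "v i = rscale (conj_transpose g *v v i) (quat_of_complex (z i))"
      using arg_cong[OF vz(2)[OF that], of "(*v) (conj_transpose g)"]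
      by (simp add: SpD[OF g] mult_rscale)
    then have "rscale (v i) (qcnj (quat_of_complex (z i))) =
      rscale (rscale (conj_transpose g *v v i) (quat_of_complex (z i))) (qcnj (quat_of_complex (z i)))"
      by simp
    then show ?thesis using vz(1)[OF that] by (simp add: qcnj_mult_self)
  qed
  have inv: "g *v w \<in> W" "conj_transpose g *v w \<in> W" "rscale w q \<in> W" if "w \<in> W" for w q
  proof -
    have "hdot (v i) (g *v w) = 0" if "i \<in> I" for i
      using hdot_mult[of "conj_transpose g" "v i" w] ct[OF that] that \<open>w \<in> W\<close> by (simp add: W_def)
    moreover have "hdot (v i) (conj_transpose g *v w) = 0" if "i \<in> I" for i
      using hdot_mult[of g "v i" w] vz(2)[OF that] that \<open>w \<in> W\<close> by (simp add: W_def)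
    ultimately show "g *v w \<in> W" "conj_transpose g *v w \<in> W" "rscale w q \<in> W"
      using that by (auto simp: W_def)
  qed
  obtain v' z' where v': "v' \<in> W" "norm v' = 1" "cmod z' = 1"
    "g *v v' = rscale v' (quat_of_complex z')"
    using unit_eigenvector_in_invariant_subspace[OF g W \<open>W \<noteq> {0}\<close> inv] by blast
  have "hdot v' (v i) = 0" if "i \<in> I" for i
    using v'(1) that qcnj_hdot[of "v i" v'] by (simp add: W_def)
  moreover have "hdot v' v' = 1" using v'(2) by (simp add: hdot_self)
  ultimately show ?case
    using v' vz \<open>k \<notin> I\<close>
    by (intro exI[of _ "v(k := v')"] exI[of _ "z(k := z')"]) (auto simp: W_def)
qed

lemma diagonal_form_exists:
  fixes g :: "quat ^ 'n ^ 'n"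
  assumes g: "g \<in> carrier Sp"
  obtains d where "diagonal_form g d"
proof -
  obtain v :: "'n \<Rightarrow> quat ^ 'n" and z where vz: "\<And>i. cmod (z i) = 1"
    "\<And>i. g *v v i = rscale (v i) (quat_of_complex (z i))"
    "\<And>i j. hdot (v i) (v j) = (if i = j then 1 else 0)"
    using orthonormal_eigenvectors[OF g, of UNIV] by blast
  define u :: "quat ^ 'n ^ 'n" where "u = (\<chi> i j. v j $ i)"
  have "conj_transpose u ** u = mat 1"
    using vz(3) by (simp add: vec_eq_iff matrix_matrix_mult_def conj_transpose_def u_def mat_def hdot_def)
  then have u: "u \<in> carrier Sp" by (rule Sp_of_left_inverse)
  have "(g ** u) $ i $ j = (u ** diag_matrix (\<lambda>k. quat_of_complex (z k))) $ i $ j" for i j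
    using arg_cong[OF vz(2), of "\<lambda>w. w $ i" j]
    unfolding mult_diag_matrix
    by (simp add: matrix_matrix_mult_def matrix_vector_mult_def u_def rscale_def)
  then have "g ** u = u ** diag_matrix (\<lambda>k. quat_of_complex (z k))"
    by (simp add: vec_eq_iff)
  then have "conj_transpose u ** g = diag_matrix (\<lambda>k. quat_of_complex (z k)) ** conj_transpose u"
    using SpD[OF u] by (metis matrix_mul_assoc matrix_mul_rid)
  then have "diagonal_form g z"
    using diagonal_form_iff[OF g] conj_transpose_in_Sp[OF u] vz(1) by blast
  then show thesis by (rule that)
qed

subsection \<open>Multiplicities\<close>

lemma Sp_intertwine:
  fixes g h u :: "quat ^ 'n ^ 'n"
  assumes "u \<in> carrier Sp" "u ** g = h ** u"
  shows "g ** conj_transpose u = conj_transpose u ** h"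
  using assms(2) SpD[OF assms(1)] by (metis matrix_mul_assoc matrix_mul_rid)

text \<open>Double counting. The unitary \<open>w\<close> intertwines the two diagonal forms, so its
  columns in \<open>?S\<close> and its rows in \<open>?S'\<close> are supported on their common
  block. All rows and columns have norm 1, so the sum of squared norms over this block equals both
  cardinalities. This makes the multiplicity well defined.\<close>

lemma card_Re_eq_of_diagonal_forms:
  fixes g :: "quat ^ 'n ^ 'n"
  assumes g: "g \<in> carrier Sp" and "diagonal_form g d" "diagonal_form g d'"
  shows "card {k. Re (d k) = c} = card {k. Re (d' k) = c}"
proof -
  let ?D = "diag_matrix (\<lambda>k. quat_of_complex (d k)) :: quat ^ 'n ^ 'n"
  let ?D' = "diag_matrix (\<lambda>k. quat_of_complex (d' k)) :: quat ^ 'n ^ 'n"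
  let ?S = "{k. Re (d k) = c}" and ?S' = "{k. Re (d' k) = c}"
  obtain u u' where u: "u \<in> carrier Sp" "u ** g = ?D ** u" and u': "u' \<in> carrier Sp" "u' ** g = ?D' ** u'"
    using assms diagonal_form_iff[OF g] by metis
  define w where "w = u' ** conj_transpose u"
  have w: "w \<in> carrier Sp" unfolding w_def by (intro Sp_mult conj_transpose_in_Sp u u')
  have "w ** ?D = ?D' ** w"
    unfolding w_def by (metis Sp_intertwine[OF u] u'(2) matrix_mul_assoc)
  then have "w $ i $ j * quat_of_complex (d j) = quat_of_complex (d' i) * w $ i $ j" for i j
    by (metis diag_matrix_mult mult_diag_matrix)
  then have zero: "w $ i $ j = 0" if "Re (d j) \<noteq> Re (d' i)" for i j
    using qre_eq_of_intertwine that by fastforce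
  have "real (card ?S) = (\<Sum>j\<in>?S. \<Sum>i\<in>UNIV. (norm (w $ i $ j))\<^sup>2)"
    by (simp add: sum_norm_row[OF w])
  also have "\<dots> = (\<Sum>j\<in>?S. \<Sum>i\<in>?S'. (norm (w $ i $ j))\<^sup>2)"
    by (intro sum.cong refl sum.mono_neutral_right) (auto simp: zero)
  also have "\<dots> = (\<Sum>i\<in>?S'. \<Sum>j\<in>?S. (norm (w $ i $ j))\<^sup>2)" by (rule sum.swap)
  also have "\<dots> = (\<Sum>i\<in>?S'. \<Sum>j\<in>UNIV. (norm (w $ i $ j))\<^sup>2)"
    by (intro sum.cong refl sum.mono_neutral_left) (auto simp: zero)
  also have "\<dots> = real (card ?S')"
    by (simp add: sum_norm_row[OF w])
  finally show ?thesis by simp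
qed

lemma class_multiplicity_eq:
  fixes g :: "quat ^ 'n ^ 'n"
  assumes "g \<in> carrier Sp" "diagonal_form g d" "cmod z = 1"
  shows "class_multiplicity g (similarity_class (quat_of_complex z)) = card {k. Re (d k) = Re z}"
proof -
  have "{k. quat_of_complex (d' k) \<in> similarity_class (quat_of_complex z)} = {k. Re (d' k) = Re z}"
    if "diagonal_form g d'" for d'
    using that assms(3) by (auto simp: diagonal_form_def quat_of_complex_mem_similarity_class_iff)
  then have "card {k. quat_of_complex (d' k) \<in> similarity_class (quat_of_complex z)}
      = card {k. Re (d k) = Re z}" if "diagonal_form g d'" for d'
    using that card_Re_eq_of_diagonal_forms[OF assms(1) that assms(2)] by simp
  then show ?thesis
    unfolding class_multiplicity_def by (intro the_equality) (use assms(2) in auto)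
qed

text \<open>In the diagonalising coordinates, any nonzero coordinate m of an eigenvector for l
  satisfies d(k) m = m l, so m itself conjugates d(k) to l. Conversely, the columns of
  \<open>conj_transpose u\<close> are eigenvectors.\<close>

lemma eigenvalue_classes_eq:
  fixes g :: "quat ^ 'n ^ 'n"
  assumes g: "g \<in> carrier Sp" and d: "diagonal_form g d"
  shows "eigenvalue_classes g = range (\<lambda>k. similarity_class (quat_of_complex (d k)))"
proof -
  let ?D = "diag_matrix (\<lambda>k. quat_of_complex (d k)) :: quat ^ 'n ^ 'n"
  obtain u where u: "u \<in> carrier Sp" "u ** g = ?D ** u"
    using d diagonal_form_iff[OF g] by metis
  have "\<exists>k. similarity_class l = similarity_class (quat_of_complex (d k))" if "is_eigenvalue g l" for l
  proof -
    obtain v where v: "v \<noteq> 0" "g *v v = rscale v l"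
      using \<open>is_eigenvalue g l\<close> by (auto simp: is_eigenvalue_def rscale_def)
    have "?D *v (u *v v) = u *v (g *v v)" by (simp add: matrix_vector_mul_assoc u)
    then have w: "?D *v (u *v v) = rscale (u *v v) l" by (simp add: v mult_rscale)
    have "u *v v \<noteq> 0" using v(1) SpD(5)[OF u(1), of v] by auto
    then obtain k where k: "(u *v v) $ k \<noteq> 0" by (auto simp: vec_eq_iff)
    let ?m = "(u *v v) $ k"
    have "quat_of_complex (d k) * ?m = ?m * l"
      using arg_cong[OF w, of "\<lambda>x. x $ k"] by (simp add: diag_matrix_vector rscale_def)
    then have "l = inverse ?m * quat_of_complex (d k) * ?m"
      using k by (metis left_inverse mult.assoc mult_1_left)
    then show ?thesis using similarity_class_conj[OF k] by metis
  qed
  moreover have "is_eigenvalue g (quat_of_complex (d k))" for k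
  proof -
    define v where "v = conj_transpose u *v axis k 1"
    have "?D *v axis k 1 = rscale (axis k 1) (quat_of_complex (d k))"
      by (simp add: vec_eq_iff diag_matrix_vector rscale_def axis_def)
    then have "g *v v = rscale v (quat_of_complex (d k))"
      unfolding v_def
      by (simp add: matrix_vector_mul_assoc Sp_intertwine[OF u])
        (simp add: matrix_vector_mul_assoc[symmetric] mult_rscale)
    moreover have "v \<noteq> 0"
      using SpD(6)[OF u(1), of "axis k 1"] by (auto simp: v_def axis_eq_0_iff)
    ultimately show ?thesis by (auto simp: is_eigenvalue_def rscale_def)
  qed
  ultimately show ?thesis unfolding eigenvalue_classes_def by blast
qed

subsection \<open>Parity of the multiplicities\<close>

text \<open>Only the real part of the trace is kept because it is cyclic, and thus conjugation
  invariant; the quaternionic trace is neither.\<close>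

definition real_trace :: "quat ^ 'n ^ 'n \<Rightarrow> real" where
  "real_trace A = (\<Sum>i\<in>UNIV. qre (A $ i $ i))"

lemma real_trace_mult_commute: "real_trace (A ** B) = real_trace (B ** A)"
proof -
  have "real_trace (A ** B) = (\<Sum>i\<in>UNIV. \<Sum>j\<in>UNIV. qre (A $ i $ j * B $ j $ i))"
    by (simp add: real_trace_def matrix_matrix_mult_def qre_sum)
  also have "\<dots> = (\<Sum>j\<in>UNIV. \<Sum>i\<in>UNIV. qre (B $ j $ i * A $ i $ j))"
    by (subst sum.swap) (simp add: qre_mult_commute)
  also have "\<dots> = real_trace (B ** A)"
    by (simp add: real_trace_def matrix_matrix_mult_def qre_sum)
  finally show ?thesis .
qed

text \<open>Diagonalising \<open>y\<close> itself gives complex entries with square 1; m counts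
  those equal to -1.\<close>

lemma real_trace_involution:
  fixes y :: "quat ^ 'n ^ 'n"
  assumes y: "y \<in> carrier Sp" "y ** y = mat 1"
  obtains m :: nat where "real_trace y = real CARD('n) - 2 * real m"
proof -
  obtain d where "diagonal_form y d" using diagonal_form_exists[OF y(1)] .
  let ?D = "diag_matrix (\<lambda>k. quat_of_complex (d k)) :: quat ^ 'n ^ 'n"
  obtain u where u: "u \<in> carrier Sp" "u ** y = ?D ** u"
    using \<open>diagonal_form y d\<close> diagonal_form_iff[OF y(1)] by metis
  have D: "?D = u ** y ** conj_transpose u"
    using u SpD[OF u(1)] by (metis matrix_mul_assoc matrix_mul_rid)
  have "?D ** ?D = mat 1"
    by (metis D SpD(2)[OF u(1)] matrix_mul_assoc matrix_mul_rid u(2) y(2))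
  then have "(?D ** ?D) $ k $ k = 1" for k by (simp add: mat_def)
  then have "quat_of_complex (d k * d k) = quat_of_complex 1" for k
    unfolding diag_matrix_mult by (simp add: diag_matrix_def quat_of_complex_mult)
  then have pm: "d k = 1 \<or> d k = -1" for k
    by (metis quat_of_complex_inj square_eq_1_iff)
  have Re: "Re (d k) = 1 - 2 * of_bool (d k = -1)" for k
    using pm[of k] by auto
  have "real_trace y = real_trace ?D"
    unfolding D using SpD[OF u(1)]
    by (metis real_trace_mult_commute matrix_mul_assoc matrix_mul_rid)
  also have "\<dots> = (\<Sum>k\<in>UNIV. 1 - 2 * of_bool (d k = -1))"
    by (simp add: real_trace_def diag_matrix_def Re)
  also have "\<dots> = real CARD('n) - 2 * real (card {k. d k = -1})"
    by (simp add: sum_subtractf sum_distrib_left[symmetric])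
  finally show thesis by (rule that)
qed

text \<open>\<open>x\<close> preserves the span of the coordinates in \<open>S\<close>; \<open>y\<close> is \<open>x\<close> there and the identity on the
  other coordinates. The diagonal entries of \<open>x\<close> in \<open>S\<close> anticommute with \<open>\<i>\<close>, so they have no real
  part, and the trace of the involution \<open>y\<close> is \<open>n - card S\<close>.\<close>

lemma even_multiplicity_of_reversing_involution:
  fixes x :: "quat ^ 'n ^ 'n"
  defines "D \<equiv> \<lambda>d :: 'n \<Rightarrow> complex. diag_matrix (\<lambda>k. quat_of_complex (d k)) :: quat ^ 'n ^ 'n"
  assumes d: "\<And>k. cmod (d k) = 1" and x: "x \<in> carrier Sp" "x ** x = mat 1"
    and xD: "x ** D d = conj_transpose (D d) ** x" and c: "c \<noteq> 1" "c \<noteq> -1"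
  shows "even (card {k. Re (d k) = c})"
proof -
  define S where "S = {k. Re (d k) = c}"
  \<comment> \<open>Both x and its adjoint are inverse to x.\<close>
  have sym: "conj_transpose x = x"
    using SpD(3)[OF x(1), of x] x(2) by simp
  then have cx: "qcnj (x $ j $ i) = x $ i $ j" for i j
    by (simp add: conj_transpose_def vec_eq_iff)
  have xd: "x $ i $ j * quat_of_complex (d j) = qcnj (quat_of_complex (d i)) * x $ i $ j" for i j
    using arg_cong[OF xD, of "\<lambda>A. A $ i $ j"]
    by (simp add: D_def conj_transpose_diag_matrix diag_matrix_mult mult_diag_matrix)
  have zero: "x $ i $ j = 0" if "(i \<in> S) \<noteq> (j \<in> S)" for i j
    using qre_eq_of_intertwine[OF xd[of i j]] that by (auto simp: S_def)
  \<comment> \<open>Filling up with the identity keeps the index type, so the trace formula for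
    involutions applies to the block without a matrix type of size \<open>card S\<close>.\<close>
  define y :: "quat ^ 'n ^ 'n" where "y = (\<chi> i j. if i \<in> S then x $ i $ j else mat 1 $ i $ j)"
  have "(\<Sum>j\<in>UNIV. y $ i $ j * y $ j $ k) = mat 1 $ i $ k" for i k
  proof (cases "i \<in> S")
    case True
    then have "(\<Sum>j\<in>UNIV. y $ i $ j * y $ j $ k) = (\<Sum>j\<in>UNIV. x $ i $ j * x $ j $ k)"
      by (intro sum.cong) (auto simp: y_def zero)
    also have "\<dots> = (x ** x) $ i $ k" by (simp add: matrix_matrix_mult_def)
    finally show ?thesis by (simp add: x)
  next
    case False
    then have "(\<Sum>j\<in>UNIV. y $ i $ j * y $ j $ k) = (\<Sum>j\<in>UNIV. if i = j then y $ j $ k else 0)"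
      by (intro sum.cong) (auto simp: y_def mat_def)
    then show ?thesis using False by (simp add: y_def)
  qed
  then have yy: "y ** y = mat 1" by (simp add: vec_eq_iff matrix_matrix_mult_def)
  have "qcnj (y $ j $ i) = y $ i $ j" for i j
    by (cases "i = j"; cases "i \<in> S"; cases "j \<in> S"; simp add: y_def cx zero mat_def)
  then have "conj_transpose y = y" by (simp add: vec_eq_iff conj_transpose_def)
  then have "y \<in> carrier Sp" using yy by (intro Sp_of_left_inverse) simp
  then obtain m where m: "real_trace y = real CARD('n) - 2 * real m"
    using real_trace_involution yy by blast
  have "qre (x $ k $ k) = 0" if "k \<in> S" for k
  proof -
    \<comment> \<open>In \<open>xd\<close> the central term Re d(k) cancels, and the i-component
      leaves 2 Im d(k) Re x(k,k) = 0. The assumption c \<noteq> 1, -1 ensures Im d(k) \<noteq>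
      0.\<close>
    have "(Re (d k))\<^sup>2 + (Im (d k))\<^sup>2 = 1" using d[of k] by (simp add: cmod_power2[symmetric])
    then have "Im (d k) \<noteq> 0" using that c by (auto simp: S_def power2_eq_1_iff)
    then show ?thesis using arg_cong[OF xd[of k k], of qi] by (simp add: quat_times_sel)
  qed
  then have "qre (y $ k $ k) = 1 - of_bool (k \<in> S)" for k
    by (simp add: y_def mat_def)
  then have "real_trace y = real CARD('n) - real (card S)"
    by (simp add: real_trace_def sum_subtractf)
  with m have "card S = 2 * m" by linarith
  then show ?thesis by (simp add: S_def)
qed

subsection \<open>Construction of a reversing involution\<close>

text \<open>\<open>s\<close> pairs elements within fibres of \<open>f\<close>, and \<open>T\<close>
  selects one member of each pair, which later decides between j and -j. Removing two elements of
  one fibre preserves all parities.\<close>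

lemma even_fibres_pairing:
  assumes "finite A" "\<And>a. a \<in> A \<Longrightarrow> even (card {b \<in> A. f b = f a})"
  shows "\<exists>s T. \<forall>a\<in>A. s a \<in> A \<and> s (s a) = a \<and> f (s a) = f a \<and> (s a \<in> T \<longleftrightarrow> a \<notin> T)"
  using assms
proof (induction A rule: finite_psubset_induct)
  case (psubset A)
  show ?case
  proof (cases "A = {}")
    case False
    then obtain a where a: "a \<in> A" by blast
    let ?F = "\<lambda>c. {b \<in> A. f b = f c}"
    have "?F a \<noteq> {a}" using psubset.prems[OF a] by auto
    then obtain b where b: "b \<in> A" "b \<noteq> a" "f b = f a" using a by blast
    let ?A = "A - {a, b}"
    have ev: "even (card {x \<in> ?A. f x = f c})" if "c \<in> ?A" for c
    proof (cases "f c = f a")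
      case True
      then have "{x \<in> ?A. f x = f c} = ?F c - {a, b}" by auto
      moreover have "card (?F c - {a, b}) = card (?F c) - 2"
        using a b True psubset.hyps by (subst card_Diff_subset) auto
      ultimately show ?thesis using psubset.prems that by simp
    next
      case False
      then have "{x \<in> ?A. f x = f c} = ?F c" using b by auto
      then show ?thesis using psubset.prems that by simp
    qed
    have "?A \<subset> A" using a by blast
    from psubset.IH[OF this ev] obtain s T where sT:
      "\<forall>a\<in>?A. s a \<in> ?A \<and> s (s a) = a \<and> f (s a) = f a \<and> (s a \<in> T \<longleftrightarrow> a \<notin> T)"
      by blast
    \<comment> \<open>The inductive \<open>T\<close> is arbitrary at \<open>a\<close> and
      \<open>b\<close>, so both memberships are reset.\<close>
    let ?s = "s(a := b, b := a)" and ?T = "insert a (T - {b})"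
    have "?s c \<in> A \<and> ?s (?s c) = c \<and> f (?s c) = f c \<and> (?s c \<in> ?T \<longleftrightarrow> c \<notin> ?T)"
      if "c \<in> A" for c
    proof (cases "c \<in> {a, b}")
      case True
      then show ?thesis using a b by fastforce
    next
      case False
      then have "c \<in> ?A" using that by blast
      from sT[rule_format, OF this] False show ?thesis by simp
    qed
    then show ?thesis by blast
  qed auto
qed

text \<open>The entries at (i, s i) and (s i, i) are conjugate, so x is Hermitian, and their product
  is \<bar>a(i)\<bar>^2 = 1. Fixed points of \<open>s\<close> are allowed.\<close>

lemma monomial_involution:
  fixes s :: "'n::finite \<Rightarrow> 'n" and a :: "'n \<Rightarrow> quat"
  defines "x \<equiv> (\<chi> i j. if j = s i then a i else 0)"
  assumes s: "\<And>k. s (s k) = k" and a: "\<And>k. a (s k) = qcnj (a k)" "\<And>k. norm (a k) = 1"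
  shows "x \<in> carrier Sp" "x ** x = mat 1"
proof -
  have "conj_transpose x = x"
    by (auto simp: x_def conj_transpose_def vec_eq_iff s a)
  moreover have "(\<Sum>j\<in>UNIV. x $ i $ j * x $ j $ k) = mat 1 $ i $ k" for i k
  proof -
    have "(\<Sum>j\<in>UNIV. x $ i $ j * x $ j $ k) = (\<Sum>j\<in>UNIV. if j = s i then a i * x $ j $ k else 0)"
      by (intro sum.cong) (auto simp: x_def)
    also have "\<dots> = a i * x $ s i $ k" by simp
    also have "\<dots> = mat 1 $ i $ k" by (auto simp: x_def s a mat_def qcnj_mult_self)
    finally show ?thesis .
  qed
  then show "x ** x = mat 1" by (simp add: vec_eq_iff matrix_matrix_mult_def)
  ultimately show "x \<in> carrier Sp" by (intro Sp_of_left_inverse) simp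
qed

lemma reversing_involution_exists:
  fixes d :: "'n::finite \<Rightarrow> complex"
  defines "D \<equiv> diag_matrix (\<lambda>k. quat_of_complex (d k)) :: quat ^ 'n ^ 'n"
  assumes d: "\<And>k. cmod (d k) = 1"
    and ev: "\<And>k. Re (d k) = 1 \<or> Re (d k) = -1 \<or> even (card {l. Re (d l) = Re (d k)})"
  shows "\<exists>x\<in>carrier Sp. x ** x = mat 1 \<and> x ** D = conj_transpose D ** x"
proof -
  define A where "A = {k. Re (d k) \<noteq> 1 \<and> Re (d k) \<noteq> -1}"
  have "even (card {l \<in> A. Re (d l) = Re (d k)})" if "k \<in> A" for k
  proof -
    have "{l \<in> A. Re (d l) = Re (d k)} = {l. Re (d l) = Re (d k)}" using that by (auto simp: A_def)
    then show ?thesis using ev[of k] that by (auto simp: A_def)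
  qed
  then obtain s T where sT: "\<And>k. k \<in> A \<Longrightarrow>
      s k \<in> A \<and> s (s k) = k \<and> Re (d (s k)) = Re (d k) \<and> (s k \<in> T \<longleftrightarrow> k \<notin> T)"
    using even_fibres_pairing[of A "\<lambda>k. Re (d k)"] by fastforce
  define s' where "s' k = (if k \<in> A then s k else k)" for k
  \<comment> \<open>Reversal demands a(k) d(s k) = conj(d(k)) a(k): 1 solves it when d(s k) is the
    conjugate of d(k), and j or -j when d(s k) = d(k). As conj(j) = -j, the two members of such a
    pair need opposite signs. Outside \<open>A\<close> the entry d(k) is 1 or -1, and 1
    suffices.\<close>
  define a where "a k = (if k \<notin> A \<or> d (s k) = cnj (d k) then 1
    else if k \<in> T then quat_j else - quat_j)" for k
  let ?x = "(\<chi> i j. if j = s' i then a i else 0) :: quat ^ 'n ^ 'n"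
  have dA: "d k = 1 \<or> d k = -1" if "k \<notin> A" for k
    using that unit_Re_eq_iff[of "d k" 1] unit_Re_eq_iff[of "d k" "-1"] d[of k] by (auto simp: A_def)
  have ds: "d (s k) = d k \<or> d (s k) = cnj (d k)" if "k \<in> A" for k
    using sT[OF that] unit_Re_eq_iff d by blast
  have qj: "qcnj quat_j = - quat_j" by (simp add: quat_eq_iff quat_j_def)
  have "s' (s' k) = k" for k using sT by (auto simp: s'_def)
  moreover have "a (s' k) = qcnj (a k)" for k
    using sT[of k] ds[of k] by (auto simp: a_def s'_def qj)
  moreover have "norm (a k) = 1" for k by (simp add: a_def)
  ultimately have "?x \<in> carrier Sp" "?x ** ?x = mat 1" by (rule monomial_involution)+
  moreover have "a k * quat_of_complex (d (s' k)) = qcnj (quat_of_complex (d k)) * a k" for k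
    using dA[of k] ds[of k] by (auto simp: a_def s'_def quat_j_mult_complex)
  then have "?x ** D = conj_transpose D ** ?x"
    unfolding D_def conj_transpose_diag_matrix
    by (auto simp: vec_eq_iff diag_matrix_mult mult_diag_matrix)
  ultimately show ?thesis by blast
qed

lemma strongly_reversible_Sp_intertwine:
  fixes g h u :: "quat ^ 'n ^ 'n"
  assumes "g \<in> carrier Sp" "h \<in> carrier Sp" and u: "u \<in> carrier Sp" "u ** g = h ** u"
    and "strongly_reversible Sp g"
  shows "strongly_reversible Sp h"
proof -
  obtain x where x: "x \<in> carrier Sp" "x ** x = mat 1" "x ** g = conj_transpose g ** x"
    using assms strongly_reversible_Sp_iff by blast
  let ?u = "conj_transpose u"
  note gu = Sp_intertwine[OF u]
  have ug: "u ** conj_transpose g = conj_transpose h ** u"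
    using arg_cong[OF gu, of conj_transpose] by (simp add: conj_transpose_mult)
  let ?y = "u ** x ** ?u"
  have "?y \<in> carrier Sp" by (intro Sp_mult conj_transpose_in_Sp u x)
  moreover have "?y ** ?y = u ** (x ** ((?u ** u) ** (x ** ?u)))"
    by (simp add: matrix_mul_assoc)
  then have "?y ** ?y = mat 1"
    using x(2) SpD[OF u(1)] by (simp add: matrix_mul_assoc)
  moreover have "?y ** h = u ** (x ** (?u ** h))" by (simp add: matrix_mul_assoc)
  then have "?y ** h = conj_transpose h ** ?y"
    by (metis gu ug x(3) matrix_mul_assoc)
  ultimately show ?thesis using strongly_reversible_Sp_iff[OF assms(2)] by blast
qed

theorem theorem1p2:
  fixes g :: "quat ^ 'n ^ 'n"
  assumes "g \<in> carrier Sp"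
  shows "strongly_reversible Sp g \<longleftrightarrow>
    (\<forall>C\<in>eigenvalue_classes g. C = {1} \<or> C = {-1} \<or> even (class_multiplicity g C))"
proof -
  obtain d where df: "diagonal_form g d" using diagonal_form_exists[OF assms] .
  let ?D = "diag_matrix (\<lambda>k. quat_of_complex (d k)) :: quat ^ 'n ^ 'n"
  obtain u where d: "\<And>k. cmod (d k) = 1" and u: "u \<in> carrier Sp" "u ** g = ?D ** u"
    using df diagonal_form_iff[OF assms] by metis
  have D: "?D \<in> carrier Sp" by (rule diag_matrix_in_Sp) (simp add: d)
  have "strongly_reversible Sp g \<longleftrightarrow> strongly_reversible Sp ?D"
    using strongly_reversible_Sp_intertwine[OF assms D u]
      strongly_reversible_Sp_intertwine[OF D assms conj_transpose_in_Sp[OF u(1)] Sp_intertwine[OF u, symmetric]]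
    by blast
  also have "\<dots> \<longleftrightarrow> (\<exists>x\<in>carrier Sp. x ** x = mat 1 \<and> x ** ?D = conj_transpose ?D ** x)"
    by (rule strongly_reversible_Sp_iff[OF D])
  \<comment> \<open>Necessity uses the parity lemma with c = Re d(k); sufficiency uses the explicit
    involution.\<close>
  also have "\<dots> \<longleftrightarrow> (\<forall>k. Re (d k) = 1 \<or> Re (d k) = -1 \<or> even (card {l. Re (d l) = Re (d k)}))"
    using even_multiplicity_of_reversing_involution[of d] reversing_involution_exists[of d] d by blast
  also have "\<dots> \<longleftrightarrow> (\<forall>C\<in>eigenvalue_classes g. C = {1} \<or> C = {-1} \<or> even (class_multiplicity g C))"
    using similarity_class_singleton_iff[OF d]
    by (auto simp: eigenvalue_classes_eq[OF assms df] class_multiplicity_eq[OF assms df d])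
  finally show ?thesis .
qed

end
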